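(* Let $A$ and $B$ be strictly positive operators on a Hilbert space $H$, and let $p,q\in(0,1]$. If $p\le q$, then $$\frac{A\nabla_pB-A\sharp_pB}{p}\ \ge\ \frac{A\nabla_qB-A\sharp_qB}{q}.$$
   Context: An operator $A\in B(H)$ (bounded linear operators on a Hilbert space $H$) is strictly positive, $A>0$, if $A\ge 0$ and $A$ is invertible. For self-adjoint $X,Y$, $X\le Y$ means $Y-X$ is positive semidefinite. For $A,B>0$ and $p\in[0,1]$: the $p$-weighted arithmetic operator mean is $A\nabla_pB=(1-p)A+pB$, and the $p$-weighted geometric operator mean is $A\sharp_pB=A^{1/2}(A^{-1/2}BA^{-1/2})^pA^{1/2}$. *)

theory Defs
  imports "HOL-Analysis.Analysis" "HOL-Computational_Algebra.Polynomial"
begin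

section \<open>Complex Hilbert spaces\<close>

class scaleC =
  fixes scaleC :: "complex \<Rightarrow> 'a \<Rightarrow> 'a"  (infixr "*\<^sub>C" 75)

text \<open>
  The inner product is linear in its first argument.  Being a subclass of \<^class>\<open>banach\<close> makes
  the operator type \<open>'a \<Rightarrow>\<^sub>L 'a\<close> available; its elements are only real-linear,
  so complex linearity is imposed separately by \<open>bop\<close> below.
\<close>

class chilbert_space = banach + scaleC +
  fixes cinner :: "'a \<Rightarrow> 'a \<Rightarrow> complex"
  assumes scaleC_add_right: "z *\<^sub>C (x + y) = z *\<^sub>C x + z *\<^sub>C y"
    and scaleC_add_left: "(z + w) *\<^sub>C x = z *\<^sub>C x + w *\<^sub>C x"
    and scaleC_scaleC: "z *\<^sub>C w *\<^sub>C x = (z * w) *\<^sub>C x"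
    and scaleC_of_real: "complex_of_real r *\<^sub>C x = r *\<^sub>R x"
    and cinner_commute: "cinner x y = cnj (cinner y x)"
    and cinner_add_left: "cinner (x + y) u = cinner x u + cinner y u"
    and cinner_scaleC_left: "cinner (z *\<^sub>C x) y = z * cinner x y"
    and norm_eq_sqrt_cinner: "norm x = sqrt (Re (cinner x x))"

lemma norm_scaleC: "norm (z *\<^sub>C x) = cmod z * norm (x :: 'a :: chilbert_space)"
proof -
  have "cinner (z *\<^sub>C x) (z *\<^sub>C x) = z * cnj (z * cinner x x)"
    by (metis cinner_scaleC_left cinner_commute)
  also have "\<dots> = (z * cnj z) * cinner x x"
    using cinner_commute[of x x] by simp
  also have "\<dots> = complex_of_real ((cmod z)\<^sup>2) * cinner x x"
    by (simp only: complex_norm_square)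
  finally show ?thesis
    by (simp add: norm_eq_sqrt_cinner real_sqrt_mult)
qed

section \<open>Bounded operators\<close>

definition bop :: "('a::chilbert_space \<Rightarrow>\<^sub>L 'a) set" where
  "bop = {T. \<forall>z x. blinfun_apply T (z *\<^sub>C x) = z *\<^sub>C blinfun_apply T x}"

lift_definition scalar_op :: "complex \<Rightarrow> ('a::chilbert_space \<Rightarrow>\<^sub>L 'a)" is "scaleC"
proof (rule bounded_linear_intro)
  fix z r and x y :: 'a
  show "z *\<^sub>C (x + y) = z *\<^sub>C x + z *\<^sub>C y" by (rule scaleC_add_right)
  show "z *\<^sub>C (r *\<^sub>R x) = r *\<^sub>R (z *\<^sub>C x)"
    by (simp add: scaleC_scaleC mult.commute flip: scaleC_of_real)
  show "norm (z *\<^sub>C x) \<le> norm x * cmod z" by (simp add: norm_scaleC)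
qed

definition op_invertible :: "('a::chilbert_space \<Rightarrow>\<^sub>L 'a) \<Rightarrow> bool" where
  "op_invertible T \<longleftrightarrow> (\<exists>S\<in>bop. S o\<^sub>L T = id_blinfun \<and> T o\<^sub>L S = id_blinfun)"

definition spectrum :: "('a::chilbert_space \<Rightarrow>\<^sub>L 'a) \<Rightarrow> complex set" where
  "spectrum T = {z. \<not> op_invertible (scalar_op z - T)}"

definition selfadjoint :: "('a::chilbert_space \<Rightarrow>\<^sub>L 'a) \<Rightarrow> bool" where
  "selfadjoint T \<longleftrightarrow> T \<in> bop \<and>
     (\<forall>x y. cinner (blinfun_apply T x) y = cinner x (blinfun_apply T y))"

text \<open>For selfadjoint \<open>T\<close> the value \<open>cinner (T x) x\<close> is real.\<close>

definition positive_op :: "('a::chilbert_space \<Rightarrow>\<^sub>L 'a) \<Rightarrow> bool" where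
  "positive_op T \<longleftrightarrow> selfadjoint T \<and> (\<forall>x. 0 \<le> Re (cinner (blinfun_apply T x) x))"

definition strictly_positive_op :: "('a::chilbert_space \<Rightarrow>\<^sub>L 'a) \<Rightarrow> bool" where
  "strictly_positive_op T \<longleftrightarrow> positive_op T \<and> op_invertible T"

definition op_le :: "('a::chilbert_space \<Rightarrow>\<^sub>L 'a) \<Rightarrow> ('a \<Rightarrow>\<^sub>L 'a) \<Rightarrow> bool"  (infix "\<le>\<^sub>o\<^sub>p" 50) where
  "X \<le>\<^sub>o\<^sub>p Y \<longleftrightarrow> selfadjoint X \<and> selfadjoint Y \<and> positive_op (Y - X)"

section \<open>Continuous functional calculus\<close>

definition op_poly :: "real poly \<Rightarrow> ('a::chilbert_space \<Rightarrow>\<^sub>L 'a) \<Rightarrow> ('a \<Rightarrow>\<^sub>L 'a)" where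
  "op_poly P T = (\<Sum>i\<le>degree P. coeff P i *\<^sub>R (((o\<^sub>L) T ^^ i) id_blinfun))"

text \<open>
  For selfadjoint \<open>T\<close> and \<open>f\<close> continuous on the (real) spectrum of \<open>T\<close>, \<open>cfc f T\<close> is the norm limit
  of \<open>P\<^sub>n(T)\<close> for any real polynomials \<open>P\<^sub>n\<close> converging to \<open>f\<close> uniformly on the spectrum.
  For other \<open>T\<close> and \<open>f\<close> the value is unspecified.
\<close>

definition cfc :: "(real \<Rightarrow> real) \<Rightarrow> ('a::chilbert_space \<Rightarrow>\<^sub>L 'a) \<Rightarrow> ('a \<Rightarrow>\<^sub>L 'a)" where
  "cfc f T = (THE S. \<forall>P :: nat \<Rightarrow> real poly.
     uniform_limit {t. complex_of_real t \<in> spectrum T} (\<lambda>n. poly (P n)) f sequentially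
       \<longrightarrow> (\<lambda>n. op_poly (P n) T) \<longlonglongrightarrow> S)"

text \<open>Only meaningful for strictly positive \<open>T\<close>, whose spectrum lies in the open half-line.\<close>

definition op_powr :: "('a::chilbert_space \<Rightarrow>\<^sub>L 'a) \<Rightarrow> real \<Rightarrow> ('a \<Rightarrow>\<^sub>L 'a)" where
  "op_powr T r = cfc (\<lambda>t. t powr r) T"

section \<open>Weighted operator means\<close>

definition arith_mean ::
  "('a::chilbert_space \<Rightarrow>\<^sub>L 'a) \<Rightarrow> real \<Rightarrow> ('a \<Rightarrow>\<^sub>L 'a) \<Rightarrow> ('a \<Rightarrow>\<^sub>L 'a)"
  ("_ \<nabla>\<^bsub>_\<^esub> _" [71, 0, 71] 70) where
  "A \<nabla>\<^bsub>p\<^esub> B = (1 - p) *\<^sub>R A + p *\<^sub>R B"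

definition geom_mean ::
  "('a::chilbert_space \<Rightarrow>\<^sub>L 'a) \<Rightarrow> real \<Rightarrow> ('a \<Rightarrow>\<^sub>L 'a) \<Rightarrow> ('a \<Rightarrow>\<^sub>L 'a)"
  ("_ \<sharp>\<^bsub>_\<^esub> _" [71, 0, 71] 70) where
  "A \<sharp>\<^bsub>p\<^esub> B =
     op_powr A (1/2) o\<^sub>L
     op_powr (op_powr A (- 1/2) o\<^sub>L B o\<^sub>L op_powr A (- 1/2)) p o\<^sub>L
     op_powr A (1/2)"

end

theory Submission
  imports Defs "HOL-Computational_Algebra.Fundamental_Theorem_Algebra"
begin

text \<open>
  With \<open>C = A\<^sup>-\<^sup>1\<^sup>/\<^sup>2 B A\<^sup>-\<^sup>1\<^sup>/\<^sup>2\<close> the quotient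
  \<open>(A \<nabla>\<^bsub>r\<^esub> B - A \<sharp>\<^bsub>r\<^esub> B) / r\<close> equals
  \<open>A\<^sup>1\<^sup>/\<^sup>2 ((1 - C\<^sup>r) / r + C - 1) A\<^sup>1\<^sup>/\<^sup>2\<close>, so by the functional calculus the claim reduces
  to the monotonicity of \<open>(t\<^sup>r - 1) / r\<close> in \<open>r\<close> for \<open>t > 0\<close>, a case of the convexity of \<open>exp\<close>.

  The functional calculus rests on one fact: a real polynomial that is nonnegative on the real
  spectrum of a selfadjoint \<open>T\<close> yields a positive operator. If \<open>m\<close> is the infimum of the numerical
  range of \<open>P(T)\<close>, then \<open>P(T) - m\<close> is not invertible. Factoring \<open>P - m\<close> over the reals, the quadratic
  factors \<open>(T - a)\<^sup>2 + b\<^sup>2\<close> are coercive and hence invertible, so a linear factor is not, and \<open>m\<close> is a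
  value of \<open>P\<close> on the spectrum.
\<close>

subsection \<open>The real inner product\<close>

text \<open>Norm, symmetry and order can all be tested on this real inner product, which suits the
  real-linear type of bounded operators.\<close>

abbreviation rinner :: "'a::chilbert_space \<Rightarrow> 'a \<Rightarrow> real" where
  "rinner x y \<equiv> Re (cinner x y)"

lemma rinner_commute: "rinner x y = rinner y x"
  by (subst cinner_commute) simp

lemma rinner_add_left: "rinner (x + y) z = rinner x z + rinner y z"
  by (simp add: cinner_add_left)

lemma rinner_add_right: "rinner z (x + y) = rinner z x + rinner z y"
  by (metis rinner_commute rinner_add_left)

lemma rinner_scaleR_left: "rinner (r *\<^sub>R x) y = r * rinner x y"
  by (simp add: cinner_scaleC_left flip: scaleC_of_real)

lemma rinner_scaleR_right: "rinner x (r *\<^sub>R y) = r * rinner x y"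
  by (metis rinner_commute rinner_scaleR_left)

lemma rinner_diff_left: "rinner (x - y) z = rinner x z - rinner y z"
  using rinner_add_left[of x "(-1) *\<^sub>R y" z] rinner_scaleR_left[of "-1" y z] by simp

lemma rinner_diff_right: "rinner z (x - y) = rinner z x - rinner z y"
  by (metis rinner_commute rinner_diff_left)

lemma rinner_zero [simp]: "rinner 0 x = 0" "rinner x 0 = 0"
  using rinner_diff_left[of 0 0 x] rinner_diff_right[of x 0 0] by simp_all

lemmas rinner_simps = rinner_add_left rinner_add_right rinner_scaleR_left rinner_scaleR_right
  rinner_diff_left rinner_diff_right

lemma rinner_self: "rinner x x = (norm x)\<^sup>2"
proof -
  \<comment> \<open>Positivity of \<open>cinner\<close> is hidden in the norm axiom:
    \<open>sqrt\<close> is odd, so a nonnegative norm forces \<open>rinner x x\<close> to be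
    nonnegative.\<close>
  have "0 \<le> sqrt (rinner x x)"
    by (metis norm_eq_sqrt_cinner norm_ge_zero)
  then show ?thesis
    by (simp add: norm_eq_sqrt_cinner)
qed

lemma Im_cinner: "Im (cinner x y) = rinner ((- \<i>) *\<^sub>C x) y"
  by (simp add: cinner_scaleC_left)

lemma scaleC_scaleR: "z *\<^sub>C (r *\<^sub>R x) = r *\<^sub>R (z *\<^sub>C (x :: 'a :: chilbert_space))"
  by (simp add: scaleC_scaleC mult.commute flip: scaleC_of_real)

lemma scaleC_diff: "z *\<^sub>C (x - y) = z *\<^sub>C x - z *\<^sub>C (y :: 'a :: chilbert_space)"
  by (metis add_diff_cancel diff_add_cancel scaleC_add_right)

lemma scaleC_zero: "z *\<^sub>C (0 :: 'a :: chilbert_space) = 0"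
  using scaleC_scaleR[of z 0 0] by simp

subsection \<open>The algebra of bounded operators\<close>

lemma bopD: "T \<in> bop \<Longrightarrow> T (z *\<^sub>C x) = z *\<^sub>C T x"
  by (simp add: bop_def)

lemma bop_zero: "0 \<in> bop"
  by (simp add: bop_def scaleC_zero)

lemma bop_id: "id_blinfun \<in> bop"
  by (simp add: bop_def)

lemma bop_add: "S \<in> bop \<Longrightarrow> T \<in> bop \<Longrightarrow> S + T \<in> bop"
  by (simp add: bop_def blinfun.bilinear_simps scaleC_add_right)

lemma bop_diff: "S \<in> bop \<Longrightarrow> T \<in> bop \<Longrightarrow> S - T \<in> bop"
  by (simp add: bop_def blinfun.bilinear_simps scaleC_diff)

lemma bop_scaleR: "T \<in> bop \<Longrightarrow> r *\<^sub>R T \<in> bop"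
  by (simp add: bop_def blinfun.bilinear_simps scaleC_scaleR)

lemma bop_compose: "S \<in> bop \<Longrightarrow> T \<in> bop \<Longrightarrow> S o\<^sub>L T \<in> bop"
  by (simp add: bop_def)

lemma blinfun_compose_assoc: "(R o\<^sub>L S) o\<^sub>L T = R o\<^sub>L (S o\<^sub>L T)"
  by (rule blinfun_eqI) simp

lemma blinfun_compose_id [simp]: "id_blinfun o\<^sub>L T = T" "T o\<^sub>L id_blinfun = T"
  by (rule blinfun_eqI, simp)+

lemmas compose_bilinear =
  bounded_bilinear.add_left[OF bounded_bilinear_blinfun_compose]
  bounded_bilinear.add_right[OF bounded_bilinear_blinfun_compose]
  bounded_bilinear.diff_left[OF bounded_bilinear_blinfun_compose]
  bounded_bilinear.diff_right[OF bounded_bilinear_blinfun_compose]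
  bounded_bilinear.scaleR_left[OF bounded_bilinear_blinfun_compose]
  bounded_bilinear.scaleR_right[OF bounded_bilinear_blinfun_compose]

lemma scalar_op_of_real: "scalar_op (complex_of_real t) = t *\<^sub>R id_blinfun"
  by (rule blinfun_eqI) (simp add: scalar_op.rep_eq blinfun.bilinear_simps scaleC_of_real)

lemma op_invertible_compose:
  assumes "op_invertible S" "op_invertible T"
  shows "op_invertible (S o\<^sub>L T)"
proof -
  obtain S' where S': "S' \<in> bop" "S' o\<^sub>L S = id_blinfun" "S o\<^sub>L S' = id_blinfun"
    using assms(1) by (auto simp: op_invertible_def)
  obtain T' where T': "T' \<in> bop" "T' o\<^sub>L T = id_blinfun" "T o\<^sub>L T' = id_blinfun"
    using assms(2) by (auto simp: op_invertible_def)
  have "(T' o\<^sub>L S') o\<^sub>L (S o\<^sub>L T) = T' o\<^sub>L ((S' o\<^sub>L S) o\<^sub>L T)"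
    and "(S o\<^sub>L T) o\<^sub>L (T' o\<^sub>L S') = S o\<^sub>L ((T o\<^sub>L T') o\<^sub>L S')"
    by (simp_all only: blinfun_compose_assoc)
  then show ?thesis
    using S' T' bop_compose by (auto simp: op_invertible_def)
qed

lemma op_invertible_scaleR:
  assumes "op_invertible T" "r \<noteq> 0"
  shows "op_invertible (r *\<^sub>R T)"
proof -
  obtain S where "S \<in> bop" "S o\<^sub>L T = id_blinfun" "T o\<^sub>L S = id_blinfun"
    using assms(1) by (auto simp: op_invertible_def)
  then show ?thesis
    unfolding op_invertible_def using assms(2)
    by (intro bexI[of _ "inverse r *\<^sub>R S"]) (simp_all add: compose_bilinear bop_scaleR)
qed

subsection \<open>Selfadjoint and positive operators\<close>

text \<open>By complex linearity, the real identity at \<open>(- \<i>) *\<^sub>C x\<close> supplies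
  the imaginary part.\<close>

lemma selfadjointI:
  assumes "T \<in> bop" and "\<And>x y. rinner (T x) y = rinner x (T y)"
  shows "selfadjoint T"
proof -
  have "cinner (T x) y = cinner x (T y)" for x y
    using assms by (auto simp: complex_eq_iff Im_cinner bopD[symmetric])
  then show ?thesis
    using assms(1) by (simp add: selfadjoint_def)
qed

lemma selfadjoint_bop: "selfadjoint T \<Longrightarrow> T \<in> bop"
  by (simp add: selfadjoint_def)

lemma selfadjointD: "selfadjoint T \<Longrightarrow> rinner (T x) y = rinner x (T y)"
  by (simp add: selfadjoint_def)

lemma selfadjoint_id: "selfadjoint id_blinfun"
  by (rule selfadjointI) (auto simp: bop_id)

lemma selfadjoint_zero: "selfadjoint 0"
  by (rule selfadjointI) (auto simp: bop_zero)

lemma selfadjoint_add: "selfadjoint S \<Longrightarrow> selfadjoint T \<Longrightarrow> selfadjoint (S + T)"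
  by (rule selfadjointI)
    (auto simp: bop_add selfadjoint_bop blinfun.bilinear_simps rinner_simps selfadjointD)

lemma selfadjoint_diff: "selfadjoint S \<Longrightarrow> selfadjoint T \<Longrightarrow> selfadjoint (S - T)"
  by (rule selfadjointI)
    (auto simp: bop_diff selfadjoint_bop blinfun.bilinear_simps rinner_simps selfadjointD)

lemma selfadjoint_scaleR: "selfadjoint T \<Longrightarrow> selfadjoint (r *\<^sub>R T)"
  by (rule selfadjointI)
    (auto simp: bop_scaleR selfadjoint_bop blinfun.bilinear_simps rinner_simps selfadjointD)

lemma selfadjoint_compose:
  assumes "selfadjoint S" "selfadjoint T" "S o\<^sub>L T = T o\<^sub>L S"
  shows "selfadjoint (S o\<^sub>L T)"
proof (rule selfadjointI)
  show "S o\<^sub>L T \<in> bop"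
    using assms by (simp add: bop_compose selfadjoint_bop)
  show "rinner ((S o\<^sub>L T) x) y = rinner x ((S o\<^sub>L T) y)" for x y
    unfolding assms(3) using assms(1,2)
    by (metis assms(3) blinfun_apply_blinfun_compose selfadjointD)
qed

lemma selfadjoint_sandwich:
  assumes "selfadjoint S" "selfadjoint T"
  shows "selfadjoint (S o\<^sub>L T o\<^sub>L S)"
  by (rule selfadjointI) (auto simp: assms bop_compose selfadjoint_bop selfadjointD)

lemma positive_sandwich:
  assumes "selfadjoint S" "positive_op T"
  shows "positive_op (S o\<^sub>L T o\<^sub>L S)"
  unfolding positive_op_def
proof
  show "selfadjoint (S o\<^sub>L T o\<^sub>L S)"
    using assms by (simp add: positive_op_def selfadjoint_sandwich)
  have "rinner ((S o\<^sub>L T o\<^sub>L S) x) x = rinner (T (S x)) (S x)" for x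
    using assms(1) by (simp add: selfadjointD)
  then show "\<forall>x. 0 \<le> rinner ((S o\<^sub>L T o\<^sub>L S) x) x"
    using assms(2) by (simp add: positive_op_def)
qed

section \<open>Cauchy-Schwarz for positive operators\<close>

lemma quadratic_nonneg_discriminant:
  fixes a b d :: real
  assumes "\<And>t. 0 \<le> a + 2 * t * b + t\<^sup>2 * d" "0 \<le> d"
  shows "b\<^sup>2 \<le> a * d"
proof (cases "d = 0")
  case True
  have "b = 0"
  proof (rule ccontr)
    assume "b \<noteq> 0"
    \<comment> \<open>For \<open>d = 0\<close> the expression is affine in \<open>t\<close>; this
      choice of \<open>t\<close> makes it \<open>-1\<close>.\<close>
    then have "a + 2 * (- (a + 1) / (2 * b)) * b = - 1" by (simp add: field_simps)
    then show False using assms(1)[of "- (a + 1) / (2 * b)"] True by simp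
  qed
  with True show ?thesis by simp
next
  case False
  \<comment> \<open>The point \<open>- b / d\<close> minimizes the quadratic.\<close>
  then have "0 \<le> (a + 2 * (- b / d) * b + (- b / d)\<^sup>2 * d) * d"
    using assms(1)[of "- b / d"] assms(2) by (intro mult_nonneg_nonneg) auto
  also have "\<dots> = a * d - b\<^sup>2"
    using False by (simp add: field_simps power2_eq_square)
  finally show ?thesis by simp
qed

text \<open>Nonnegativity of the form of \<open>T\<close> at \<open>x + t y\<close> for all real
  \<open>t\<close> bounds its discriminant. The identity operator gives the usual
  inequality.\<close>

lemma positive_op_Cauchy_Schwarz:
  assumes "positive_op T"
  shows "(rinner (T x) y)\<^sup>2 \<le> rinner (T x) x * rinner (T y) y"
proof (rule quadratic_nonneg_discriminant)
  have T: "selfadjoint T" and pos: "\<And>x. 0 \<le> rinner (T x) x"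
    using assms by (auto simp: positive_op_def)
  show "0 \<le> rinner (T y) y" by (rule pos)
  fix t :: real
  have "0 \<le> rinner (T (x + t *\<^sub>R y)) (x + t *\<^sub>R y)" by (rule pos)
  moreover have "rinner (T y) x = rinner (T x) y"
    using T by (metis rinner_commute selfadjointD)
  ultimately show "0 \<le> rinner (T x) x + 2 * t * rinner (T x) y + t\<^sup>2 * rinner (T y) y"
    by (simp add: blinfun.bilinear_simps rinner_simps algebra_simps power2_eq_square)
qed

lemma rinner_le_norm: "\<bar>rinner x y\<bar> \<le> norm x * norm y"
proof -
  have "positive_op (id_blinfun :: 'a \<Rightarrow>\<^sub>L 'a)"
    by (simp add: positive_op_def selfadjoint_id rinner_self)
  from positive_op_Cauchy_Schwarz[OF this, of x y]
  have "\<bar>rinner x y\<bar> \<le> \<bar>norm x * norm y\<bar>"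
    unfolding abs_le_square_iff by (simp add: rinner_self power_mult_distrib)
  then show ?thesis by (simp add: abs_mult)
qed

lemma rinner_apply_le:
  fixes T :: "'a::chilbert_space \<Rightarrow>\<^sub>L 'a"
  shows "rinner (T x) x \<le> norm T * (norm x)\<^sup>2"
proof -
  have "rinner (T x) x \<le> norm (T x) * norm x"
    using rinner_le_norm[of "T x" x] by simp
  also have "\<dots> \<le> (norm T * norm x) * norm x"
    by (intro mult_right_mono norm_blinfun) auto
  finally show ?thesis by (simp add: power2_eq_square)
qed

section \<open>Limits of operators\<close>

lemma tendsto_rinner:
  assumes "(f \<longlongrightarrow> a) F"
  shows "((\<lambda>n. rinner (f n) y) \<longlongrightarrow> rinner a y) F"
proof -
  have "bounded_linear (\<lambda>x. rinner x y)"
    using rinner_le_norm[of _ y]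
    by (intro bounded_linear_intro[where K = "norm y"]) (auto simp: rinner_simps)
  then show ?thesis
    using assms by (rule bounded_linear.tendsto)
qed

lemma tendsto_blinfun_apply:
  "(f \<longlongrightarrow> T) F \<Longrightarrow> ((\<lambda>n. blinfun_apply (f n) x) \<longlongrightarrow> blinfun_apply T x) F"
  by (intro tendsto_intros)

lemma tendsto_blinfun_compose:
  "(f \<longlongrightarrow> S) F \<Longrightarrow> (g \<longlongrightarrow> T) F \<Longrightarrow> ((\<lambda>n. f n o\<^sub>L g n) \<longlongrightarrow> S o\<^sub>L T) F"
  by (rule bounded_bilinear.tendsto[OF bounded_bilinear_blinfun_compose])

text \<open>Symmetry and complex linearity both pass to pointwise limits. Linearity has to be
  checked because convergence takes place among real-linear operators.\<close>

lemma selfadjoint_limit: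
  assumes "X \<longlonglongrightarrow> T" "\<And>n::nat. selfadjoint (X n)"
  shows "selfadjoint T"
proof (rule selfadjointI)
  note lim = tendsto_blinfun_apply[OF assms(1)]
  have "(\<lambda>n. X n (z *\<^sub>C x)) \<longlonglongrightarrow> z *\<^sub>C T x" for z x
    using bounded_linear.tendsto[OF blinfun.bounded_linear_right[of "scalar_op z"] lim[of x]]
    by (simp add: scalar_op.rep_eq bopD[OF selfadjoint_bop] assms(2))
  then show "T \<in> bop"
    unfolding bop_def using LIMSEQ_unique lim by blast
  fix x y
  have "(\<lambda>n. rinner (X n x) y) \<longlonglongrightarrow> rinner (T x) y"
    by (intro tendsto_rinner lim)
  moreover have "(\<lambda>n. rinner (X n y) x) \<longlonglongrightarrow> rinner (T y) x"
    by (intro tendsto_rinner lim)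
  moreover have "rinner (X n y) x = rinner (X n x) y" for n
    by (metis assms(2) rinner_commute selfadjointD)
  ultimately show "rinner (T x) y = rinner x (T y)"
    by (metis (no_types, lifting) LIMSEQ_unique ext rinner_commute)
qed

subsection \<open>Coercivity and invertibility\<close>

text \<open>For small \<open>s > 0\<close> the map \<open>1 - s T\<close> is a strict contraction, so \<open>T x = y\<close> is solved by a
  fixed point iteration.\<close>

lemma coercive_surj:
  fixes T :: "'a::chilbert_space \<Rightarrow>\<^sub>L 'a"
  assumes c: "0 < c" "\<And>x. c * (norm x)\<^sup>2 \<le> rinner (T x) x"
  shows "\<exists>x. T x = y"
proof -
  \<comment> \<open>The summand \<open>c\<close> keeps \<open>M\<close> positive and gives
    \<open>c \<le> M\<close>, hence \<open>0 \<le> k\<close> below.\<close>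
  define M where "M = norm T + c"
  \<comment> \<open>The squared contraction factor is at most \<open>1 - 2 s c + s^2 M^2\<close>;
    this \<open>s\<close> minimizes the bound, with minimum \<open>k = 1 - s c\<close>.\<close>
  define s where "s = c / M\<^sup>2"
  have M: "0 < M" "c \<le> M" "norm T \<le> M"
    using c(1) by (auto simp: M_def add_nonneg_pos)
  have s: "0 < s" using M c by (simp add: s_def)
  have sM: "s * M\<^sup>2 = c" using M by (simp add: s_def)
  define k where "k = 1 - s * c"
  have "c\<^sup>2 \<le> M\<^sup>2" using M c by (intro power_mono) auto
  then have "s * c \<le> 1" using M by (simp add: s_def power2_eq_square)
  then have k: "0 \<le> k" "k < 1" using s c by (auto simp: k_def)
  have contr: "norm (x - s *\<^sub>R T x) \<le> sqrt k * norm x" for x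
  proof -
    have "(norm (T x))\<^sup>2 \<le> (M * norm x)\<^sup>2"
      using norm_blinfun[of T x] mult_right_mono[OF M(3) norm_ge_zero[of x]]
      by (intro power_mono) (linarith, simp)
    then have Tx: "s\<^sup>2 * (norm (T x))\<^sup>2 \<le> s\<^sup>2 * (M * norm x)\<^sup>2"
      by (intro mult_left_mono) auto
    have "(norm (x - s *\<^sub>R T x))\<^sup>2 = (norm x)\<^sup>2 - 2 * s * rinner (T x) x + s\<^sup>2 * (norm (T x))\<^sup>2"
      unfolding rinner_self[symmetric]
      by (simp add: rinner_simps rinner_commute[of x "T x"] power2_eq_square algebra_simps)
    also have "\<dots> \<le> (norm x)\<^sup>2 - 2 * s * (c * (norm x)\<^sup>2) + s\<^sup>2 * (M * norm x)\<^sup>2"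
      using mult_left_mono[OF c(2)[of x], of "2 * s"] s Tx by linarith
    also have "s\<^sup>2 * (M * norm x)\<^sup>2 = s * (s * M\<^sup>2) * (norm x)\<^sup>2"
      by (simp add: power2_eq_square)
    also have "(norm x)\<^sup>2 - 2 * s * (c * (norm x)\<^sup>2) + s * (s * M\<^sup>2) * (norm x)\<^sup>2 = k * (norm x)\<^sup>2"
      unfolding sM by (simp add: k_def algebra_simps)
    finally have "sqrt ((norm (x - s *\<^sub>R T x))\<^sup>2) \<le> sqrt (k * (norm x)\<^sup>2)"
      by (rule real_sqrt_le_mono)
    then show ?thesis by (simp add: real_sqrt_mult)
  qed
  have "\<exists>!x. x - s *\<^sub>R T x + s *\<^sub>R y = x"
  proof (rule banach_fix_type[of "sqrt k"])
    show "\<forall>x z. dist (x - s *\<^sub>R T x + s *\<^sub>R y) (z - s *\<^sub>R T z + s *\<^sub>R y) \<le> sqrt k * dist x z"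
    proof (intro allI)
      fix x z
      have "x - s *\<^sub>R T x + s *\<^sub>R y - (z - s *\<^sub>R T z + s *\<^sub>R y) = (x - z) - s *\<^sub>R T (x - z)"
        by (simp add: blinfun.bilinear_simps algebra_simps)
      then show "dist (x - s *\<^sub>R T x + s *\<^sub>R y) (z - s *\<^sub>R T z + s *\<^sub>R y) \<le> sqrt k * dist x z"
        by (simp only: dist_norm contr)
    qed
  qed (use k in auto)
  then obtain x where "x - s *\<^sub>R T x + s *\<^sub>R y = x" by blast
  then have "s *\<^sub>R y = s *\<^sub>R T x" by (simp add: algebra_simps)
  then have "T x = y" using s by simp
  then show ?thesis ..
qed

text \<open>Lax-Milgram argument: \<open>coercive_surj\<close> gives a right inverse
  \<open>g\<close>, while \<open>c * norm x \<le> norm (T x)\<close> makes \<open>T\<close>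
  injective and bounds \<open>g\<close> by \<open>1 / c\<close>.\<close>

lemma coercive_invertible:
  assumes T: "T \<in> bop" and c: "0 < c" "\<And>x. c * (norm x)\<^sup>2 \<le> rinner (T x) x"
  shows "op_invertible T"
proof -
  obtain g where g: "\<And>y. T (g y) = y"
    using coercive_surj[OF c] by metis
  have below: "c * norm x \<le> norm (T x)" for x
  proof (cases "x = 0")
    case False
    have "c * norm x * norm x \<le> norm (T x) * norm x"
      using c(2)[of x] rinner_le_norm[of "T x" x] by (simp add: power2_eq_square)
    then show ?thesis using False by simp
  qed simp
  have inj: "x = z" if "T x = T z" for x z
  proof -
    have "c * norm (x - z) \<le> 0"
      using below[of "x - z"] that by (simp add: blinfun.bilinear_simps)
    then show ?thesis using c(1) by (simp add: mult_le_0_iff)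
  qed
  \<comment> \<open>The linearity laws hold after applying \<open>T\<close>, hence by
    injectivity.\<close>
  have "bounded_linear g"
  proof (rule bounded_linear_intro)
    show "norm (g y) \<le> norm y * inverse c" for y
      using below[of "g y"] c(1) g by (simp add: field_simps)
  qed (rule inj, simp add: g blinfun.bilinear_simps)+
  then have ap: "blinfun_apply (Blinfun g) = g"
    by (rule bounded_linear_Blinfun_apply)
  have "g (z *\<^sub>C y) = z *\<^sub>C g y" for z y
    by (rule inj) (simp add: g bopD[OF T])
  then have "Blinfun g \<in> bop"
    by (simp add: bop_def ap)
  moreover have "Blinfun g o\<^sub>L T = id_blinfun"
    by (rule blinfun_eqI, rule inj) (simp add: ap g)
  moreover have "T o\<^sub>L Blinfun g = id_blinfun"
    by (rule blinfun_eqI) (simp add: ap g)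
  ultimately show ?thesis by (auto simp: op_invertible_def)
qed

text \<open>Converse of \<open>coercive_invertible\<close> for positive \<open>T\<close>. With
  \<open>S\<close> the inverse, Cauchy-Schwarz for the form of \<open>T\<close> at
  \<open>S x\<close> and \<open>x\<close> gives
  \<open>(norm x)^4 \<le> rinner (S x) x * rinner (T x) x\<close>.\<close>

lemma positive_invertible_coercive:
  fixes T :: "'a::chilbert_space \<Rightarrow>\<^sub>L 'a"
  assumes T: "positive_op T" "op_invertible T"
  obtains c where "0 < c" "\<And>x. c * (norm x)\<^sup>2 \<le> rinner (T x) x"
proof -
  obtain S where S: "S o\<^sub>L T = id_blinfun" "T o\<^sub>L S = id_blinfun"
    using T(2) by (auto simp: op_invertible_def)
  have TS: "T (S x) = x" for x
    using S(2) by (metis blinfun_apply_blinfun_compose blinfun_apply_id_blinfun id_apply)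
  define M where "M = norm S + 1"
  have M: "0 < M" "norm S \<le> M" by (auto simp: M_def add_nonneg_pos)
  have "(norm x)\<^sup>2 \<le> M * rinner (T x) x" for x
  proof (cases "x = 0")
    case True
    then show ?thesis using T(1) M by (simp add: positive_op_def)
  next
    case False
    have "((norm x)\<^sup>2)\<^sup>2 = (rinner (T (S x)) x)\<^sup>2"
      by (simp add: TS rinner_self)
    also have "\<dots> \<le> rinner (T (S x)) (S x) * rinner (T x) x"
      by (rule positive_op_Cauchy_Schwarz[OF T(1)])
    also have "\<dots> = rinner (S x) x * rinner (T x) x"
      by (simp add: TS rinner_commute[of x])
    also have "\<dots> \<le> (M * (norm x)\<^sup>2) * rinner (T x) x"
      using rinner_apply_le[of S x] M T(1) mult_right_mono[OF M(2), of "(norm x)\<^sup>2"]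
      by (intro mult_right_mono) (auto simp: positive_op_def)
    finally have "(norm x)\<^sup>2 * (norm x)\<^sup>2 \<le> (norm x)\<^sup>2 * (M * rinner (T x) x)"
      by (simp add: power2_eq_square algebra_simps)
    then show ?thesis by (rule mult_left_le_imp_le) (use False in simp)
  qed
  then have "inverse M * (norm x)\<^sup>2 \<le> rinner (T x) x" for x
    using M by (simp add: field_simps)
  then show ?thesis using that[of "inverse M"] M by simp
qed

subsection \<open>Polynomials of an operator and the real spectrum\<close>

lemma op_poly_altdef:
  assumes "degree P \<le> n"
  shows "op_poly P T = (\<Sum>i\<le>n. coeff P i *\<^sub>R (((o\<^sub>L) T ^^ i) id_blinfun))"
  unfolding op_poly_def
  by (rule sum.mono_neutral_left) (use assms in \<open>auto simp: coeff_eq_0\<close>)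

lemma op_poly_0 [simp]: "op_poly 0 T = 0"
  by (simp add: op_poly_def)

text \<open>Horner's rule, the basis of the inductions behind the algebra laws of
  \<open>op_poly\<close>.\<close>

lemma op_poly_pCons [simp]: "op_poly (pCons a P) T = a *\<^sub>R id_blinfun + (T o\<^sub>L op_poly P T)"
proof -
  have "op_poly (pCons a P) T =
      (\<Sum>i\<le>Suc (degree P). coeff (pCons a P) i *\<^sub>R (((o\<^sub>L) T ^^ i) id_blinfun))"
    by (rule op_poly_altdef) (rule degree_pCons_le)
  also have "\<dots> = a *\<^sub>R id_blinfun + (\<Sum>i\<le>degree P. T o\<^sub>L (coeff P i *\<^sub>R (((o\<^sub>L) T ^^ i) id_blinfun)))"
    by (simp add: sum.atMost_Suc_shift compose_bilinear del: sum.atMost_Suc)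
  finally show ?thesis
    by (simp add: op_poly_def bounded_bilinear.sum_right[OF bounded_bilinear_blinfun_compose])
qed

lemma op_poly_add: "op_poly (P + Q) T = op_poly P T + op_poly Q T"
  by (induction P Q rule: poly_induct2) (simp_all add: compose_bilinear algebra_simps)

lemma op_poly_smult: "op_poly (smult a P) T = a *\<^sub>R op_poly P T"
  by (induction P) (simp_all add: compose_bilinear algebra_simps)

lemma op_poly_diff: "op_poly (P - Q) T = op_poly P T - op_poly Q T"
  using op_poly_add[of "P - Q" Q T] by simp

lemma op_poly_mult: "op_poly (P * Q) T = op_poly P T o\<^sub>L op_poly Q T"
  by (induction P) (simp_all add: compose_bilinear op_poly_add op_poly_smult blinfun_compose_assoc)

lemma op_poly_selfadjoint:
  assumes "selfadjoint T"
  shows "selfadjoint (op_poly P T)"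
proof (induction P)
  case 0
  show ?case by (simp add: selfadjoint_zero)
next
  case (pCons a P)
  \<comment> \<open>Both sides are \<open>op_poly\<close> of a product with the monomial
    \<open>[:0, 1:]\<close>, and polynomials commute.\<close>
  have "T o\<^sub>L op_poly P T = op_poly P T o\<^sub>L T"
    using op_poly_mult[of "[:0, 1:]" P T] op_poly_mult[of P "[:0, 1:]" T] by (simp add: mult.commute)
  then show ?case
    using assms pCons
    by (auto intro!: selfadjoint_add selfadjoint_scaleR selfadjoint_id selfadjoint_compose)
qed

section \<open>Real spectrum and invertibility of polynomials in \<open>T\<close>\<close>

abbreviation real_spectrum :: "('a::chilbert_space \<Rightarrow>\<^sub>L 'a) \<Rightarrow> real set" where
  "real_spectrum T \<equiv> {t. complex_of_real t \<in> spectrum T}"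

lemma real_spectrum_iff:
  "complex_of_real t \<in> spectrum T \<longleftrightarrow> \<not> op_invertible (T - t *\<^sub>R id_blinfun)"
  using op_invertible_scaleR[of "T - t *\<^sub>R id_blinfun" "-1"]
    op_invertible_scaleR[of "t *\<^sub>R id_blinfun - T" "-1"]
  by (auto simp: spectrum_def scalar_op_of_real)

lemma map_poly_of_real_add:
  "map_poly complex_of_real (P + Q) = map_poly of_real P + map_poly of_real Q"
  by (rule poly_eqI) (simp add: coeff_map_poly)

lemma map_poly_of_real_mult:
  "map_poly complex_of_real (P * Q) = map_poly of_real P * map_poly of_real Q"
proof (induction P)
  case (pCons a P)
  have "map_poly complex_of_real (smult a Q) = smult (of_real a) (map_poly of_real Q)"
    by (rule poly_eqI) (simp add: coeff_map_poly)
  with pCons show ?case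
    by (simp add: map_poly_of_real_add map_poly_pCons)
qed simp

text \<open>The divisor has the roots \<open>z\<close> and its conjugate. The remainder modulo it is
  at most linear with real coefficients, and vanishing at a nonreal point makes it zero.\<close>

lemma real_poly_complex_root_dvd:
  assumes "poly (map_poly complex_of_real P) z = 0" "Im z \<noteq> 0"
  shows "[:(Re z)\<^sup>2 + (Im z)\<^sup>2, - 2 * Re z, 1:] dvd P"
proof -
  define D where "D = [:(Re z)\<^sup>2 + (Im z)\<^sup>2, - 2 * Re z, 1:]"
  define R where "R = P mod D"
  have "degree R < degree D \<or> R = 0"
    using degree_mod_less'[of D P] by (auto simp: R_def D_def)
  then have "degree R \<le> 1" by (auto simp: D_def)
  then obtain a b where R: "R = [:a, b:]"
    using degree1_coeffs by (metis One_nat_def degree_0 degree_eq_zeroE le_Suc_eq le_zero_eq pCons_0_0)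
  have "poly (map_poly complex_of_real D) z = 0"
    by (simp add: D_def map_poly_pCons complex_eq_iff power2_eq_square algebra_simps)
  moreover have "P = D * (P div D) + R"
    by (simp add: R_def)
  ultimately have "poly (map_poly complex_of_real R) z = 0"
    using assms(1) by (metis add_0 map_poly_of_real_add map_poly_of_real_mult mult_zero_left poly_add poly_mult)
  then have "R = 0"
    using assms(2) by (auto simp: R map_poly_pCons complex_eq_iff)
  then show ?thesis
    unfolding D_def[symmetric] R_def by auto
qed

text \<open>Completing the square: with \<open>S = T - a\<close> the quadratic form is
  \<open>(norm (S x))^2 + b^2 (norm x)^2\<close>, so \<open>b^2\<close> is a coercivity
  constant.\<close>

lemma quadratic_invertible:
  assumes "selfadjoint T" "b \<noteq> 0"
  shows "op_invertible (op_poly [:a\<^sup>2 + b\<^sup>2, - 2 * a, 1:] T)"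
proof (rule coercive_invertible)
  define S where "S = T - a *\<^sub>R id_blinfun"
  have S: "selfadjoint S"
    by (auto simp: S_def assms(1) intro!: selfadjoint_diff selfadjoint_scaleR selfadjoint_id)
  show "0 < b\<^sup>2" using assms(2) by simp
  show "op_poly [:a\<^sup>2 + b\<^sup>2, - 2 * a, 1:] T \<in> bop"
    using assms(1) op_poly_selfadjoint selfadjoint_bop by blast
  have "op_poly [:a\<^sup>2 + b\<^sup>2, - 2 * a, 1:] T = b\<^sup>2 *\<^sub>R id_blinfun + (S o\<^sub>L S)"
    by (simp add: S_def compose_bilinear algebra_simps power2_eq_square flip: scaleR_add_left)
  then show "b\<^sup>2 * (norm x)\<^sup>2 \<le> rinner (op_poly [:a\<^sup>2 + b\<^sup>2, - 2 * a, 1:] T x) x" for x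
    using S by (simp add: blinfun.bilinear_simps rinner_simps selfadjointD rinner_self)
qed

text \<open>One half of the spectral mapping theorem: real roots lie off the spectrum, nonreal pairs
  give invertible quadratics, and invertible factors multiply.\<close>

lemma op_poly_invertible:
  assumes T: "selfadjoint T"
  shows "P \<noteq> 0 \<Longrightarrow> (\<And>t. t \<in> real_spectrum T \<Longrightarrow> poly P t \<noteq> 0) \<Longrightarrow> op_invertible (op_poly P T)"
proof (induction "degree P" arbitrary: P rule: less_induct)
  case less
  have id: "op_invertible (id_blinfun :: 'a \<Rightarrow>\<^sub>L 'a)"
    by (auto simp: op_invertible_def intro!: bexI[of _ id_blinfun] bop_id)
  \<comment> \<open>Inductive step for both kinds of factor: \<open>Q\<close> has smaller degree and
    no root on the real spectrum.\<close>
  have split: "op_invertible (op_poly P T)"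
    if "P = D * Q" "0 < degree D" "op_invertible (op_poly D T)" for D Q
  proof -
    have "D \<noteq> 0" "Q \<noteq> 0" using that less.prems by auto
    then have "degree Q < degree P" using that by (simp add: degree_mult_eq)
    moreover have "poly Q t \<noteq> 0" if "t \<in> real_spectrum T" for t
      using less.prems(2)[OF that] \<open>P = D * Q\<close> by auto
    ultimately have "op_invertible (op_poly Q T)"
      using less.hyps \<open>Q \<noteq> 0\<close> by blast
    then show ?thesis
      using that op_invertible_compose by (simp add: op_poly_mult)
  qed
  show ?case
  proof (cases "degree P = 0")
    case True
    then obtain a where "P = [:a:]" by (rule degree_eq_zeroE)
    then show ?thesis using less.prems(1) op_invertible_scaleR[OF id] by simp
  next
    case False
    then have "\<not> constant (poly (map_poly complex_of_real P))"
      by (simp add: constant_degree degree_map_poly)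
    then obtain z where z: "poly (map_poly complex_of_real P) z = 0"
      using fundamental_theorem_of_algebra by blast
    show ?thesis
    proof (cases "Im z = 0")
      case True
      then have "z = complex_of_real (Re z)" by (simp add: complex_eq_iff)
      moreover have "poly (map_poly complex_of_real Q) (of_real t) = of_real (poly Q t)" for Q t
        by (induction Q) (auto simp: map_poly_pCons)
      ultimately have root: "poly P (Re z) = 0"
        using z by (metis of_real_eq_0_iff)
      then obtain Q where Q: "P = [:- Re z, 1:] * Q"
        by (auto simp: poly_eq_0_iff_dvd elim: dvdE)
      have "op_invertible (op_poly [:- Re z, 1:] T)"
        using root less.prems(2)[of "Re z"] by (auto simp: real_spectrum_iff)
      then show ?thesis by (intro split[OF Q]) auto
    next
      case False
      then obtain Q where Q: "P = [:(Re z)\<^sup>2 + (Im z)\<^sup>2, - 2 * Re z, 1:] * Q"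
        using real_poly_complex_root_dvd[OF z] by (auto elim: dvdE)
      show ?thesis
        by (rule split[OF Q _ quadratic_invertible[OF T False]]) simp
    qed
  qed
qed

section \<open>Numerical range and spectral positivity\<close>

lemma numerical_range_infimum:
  fixes T :: "'a::chilbert_space \<Rightarrow>\<^sub>L 'a"
  assumes T: "selfadjoint T" and "x\<^sub>0 \<noteq> (0 :: 'a)"
  obtains m where "\<And>x. m * (norm x)\<^sup>2 \<le> rinner (T x) x" "m \<in> real_spectrum T"
proof -
  define W where "W = {rinner (T x) x / (norm x)\<^sup>2 | x. x \<noteq> 0}"
  define m where "m = Inf W"
  \<comment> \<open>The given nonzero vector enters here; on the zero space the spectrum is
    empty.\<close>
  have W_ne: "W \<noteq> {}" using assms(2) by (auto simp: W_def)
  have "- norm T \<le> w" if w: "w \<in> W" for w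
  proof -
    obtain x where x: "x \<noteq> 0" "w = rinner (T x) x / (norm x)\<^sup>2"
      using w by (auto simp: W_def)
    have "- norm T * (norm x)\<^sup>2 \<le> rinner (T x) x"
      using rinner_apply_le[of "- T" x] rinner_diff_left[of 0 "T x" x]
      by (simp add: blinfun.bilinear_simps)
    then show ?thesis using x by (simp add: pos_le_divide_eq)
  qed
  then have "bdd_below W" by (rule bdd_belowI)
  then have lower: "m * (norm x)\<^sup>2 \<le> rinner (T x) x" for x
  proof (cases "x = 0")
    case False
    then have "m \<le> rinner (T x) x / (norm x)\<^sup>2"
      unfolding m_def using \<open>bdd_below W\<close> by (intro cInf_lower) (auto simp: W_def)
    then show ?thesis using False by (simp add: field_simps)
  qed (simp add: blinfun.bilinear_simps)
  have quad: "rinner ((T - m *\<^sub>R id_blinfun) x) x = rinner (T x) x - m * (norm x)\<^sup>2" for x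
    by (simp add: blinfun.bilinear_simps rinner_simps rinner_self)
  have "\<not> op_invertible (T - m *\<^sub>R id_blinfun)"
  proof
    assume inv: "op_invertible (T - m *\<^sub>R id_blinfun)"
    have "positive_op (T - m *\<^sub>R id_blinfun)"
      unfolding positive_op_def quad
      using T lower by (auto intro!: selfadjoint_diff selfadjoint_scaleR selfadjoint_id)
    \<comment> \<open>Coercivity of \<open>T - m\<close> would raise the lower bound of
      \<open>W\<close> to \<open>m + c\<close>, contradicting the infimum.\<close>
    then obtain c where c: "0 < c"
      "\<And>x. c * (norm x)\<^sup>2 \<le> rinner ((T - m *\<^sub>R id_blinfun) x) x"
      using positive_invertible_coercive[OF _ inv] by blast
    have "m + c \<le> w" if w: "w \<in> W" for w
    proof -
      obtain x where x: "x \<noteq> 0" "w = rinner (T x) x / (norm x)\<^sup>2"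
        using w by (auto simp: W_def)
      show ?thesis
        using c(2)[of x] x unfolding quad by (simp add: pos_le_divide_eq algebra_simps)
    qed
    then have "m + c \<le> Inf W" using W_ne by (intro cInf_greatest)
    then show False using c(1) by (simp add: m_def)
  qed
  then show ?thesis
    using that[OF lower] by (simp add: real_spectrum_iff)
qed

lemma op_poly_positive:
  assumes T: "selfadjoint T" and P: "\<And>t. t \<in> real_spectrum T \<Longrightarrow> 0 \<le> poly P t"
  shows "positive_op (op_poly P T)"
  unfolding positive_op_def
proof (intro conjI allI)
  show S: "selfadjoint (op_poly P T)"
    using T by (rule op_poly_selfadjoint)
  fix x\<^sub>0
  show "0 \<le> rinner (op_poly P T x\<^sub>0) x\<^sub>0"
  proof (cases "x\<^sub>0 = 0")
    case False
    obtain m where m: "\<And>x. m * (norm x)\<^sup>2 \<le> rinner (op_poly P T x) x"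
      "m \<in> real_spectrum (op_poly P T)"
      using numerical_range_infimum[OF S False] by blast
    \<comment> \<open>A spectral point settles the case \<open>P = [:m:]\<close>, where there is
      nothing to factor: \<open>m\<close> is the value of \<open>P\<close> at this point.\<close>
    obtain t where t: "t \<in> real_spectrum T"
      using numerical_range_infimum[OF T False] by blast
    have "op_poly (P - [:m:]) T = op_poly P T - m *\<^sub>R id_blinfun"
      by (simp add: op_poly_diff)
    then have "\<not> op_invertible (op_poly (P - [:m:]) T)"
      using m(2) by (simp add: real_spectrum_iff)
    then have "P = [:m:] \<or> (\<exists>t\<in>real_spectrum T. poly P t = m)"
      using op_poly_invertible[OF T, of "P - [:m:]"] by auto
    then have "0 \<le> m"
      using P t by auto
    then have "0 \<le> m * (norm x\<^sub>0)\<^sup>2" by simp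
    then show ?thesis using m(1) order_trans by blast
  qed simp
qed

lemma op_poly_norm_le:
  assumes T: "selfadjoint T" and e: "0 \<le> e"
    and P: "\<And>t. t \<in> real_spectrum T \<Longrightarrow> \<bar>poly P t\<bar> \<le> e"
  shows "norm (op_poly P T) \<le> e"
proof (rule norm_blinfun_bound[OF e])
  fix x
  let ?S = "op_poly P T"
  \<comment> \<open>\<open>P(T)\<^sup>2 \<le> e\<^sup>2\<close> is exactly the norm bound for selfadjoint \<open>P(T)\<close>.\<close>
  have "positive_op (op_poly ([:e\<^sup>2:] - P * P) T)"
  proof (rule op_poly_positive[OF T])
    fix t assume "t \<in> real_spectrum T"
    then have "(poly P t)\<^sup>2 \<le> e\<^sup>2"
      using P e by (metis abs_le_square_iff abs_of_nonneg)
    then show "0 \<le> poly ([:e\<^sup>2:] - P * P) t"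
      by (simp add: power2_eq_square)
  qed
  moreover have "op_poly ([:e\<^sup>2:] - P * P) T = e\<^sup>2 *\<^sub>R id_blinfun - (?S o\<^sub>L ?S)"
    by (simp add: op_poly_diff op_poly_mult)
  ultimately have "0 \<le> rinner ((e\<^sup>2 *\<^sub>R id_blinfun - (?S o\<^sub>L ?S)) x) x"
    by (simp add: positive_op_def)
  then have "(norm (?S x))\<^sup>2 \<le> (e * norm x)\<^sup>2"
    using selfadjointD[OF op_poly_selfadjoint[OF T, of P], of "?S x" x]
    by (simp add: blinfun.bilinear_simps rinner_simps rinner_self power_mult_distrib)
  then show "norm (?S x) \<le> e * norm x"
    by (rule power2_le_imp_le) (use e in simp)
qed

subsection \<open>Continuous functional calculus\<close>

text \<open>Stone-Weierstrass with error \<open>1 / (n + 1)\<close>, its polynomial functions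
  rewritten through \<open>poly\<close>.\<close>

lemma Weierstrass_uniform_limit:
  fixes f :: "real \<Rightarrow> real"
  assumes "continuous_on {a..b} f"
  obtains P :: "nat \<Rightarrow> real poly"
  where "uniform_limit {a..b} (\<lambda>n. poly (P n)) f sequentially"
proof -
  have "\<exists>P. \<forall>x\<in>{a..b}. \<bar>f x - poly P x\<bar> < inverse (real (Suc n))" for n
  proof -
    obtain g where g: "real_polynomial_function g"
      "\<And>x. x \<in> {a..b} \<Longrightarrow> \<bar>f x - g x\<bar> < inverse (real (Suc n))"
      using Stone_Weierstrass_real_polynomial_function[OF compact_Icc assms, of "inverse (real (Suc n))"]
      by auto
    obtain c N where "g = (\<lambda>x. \<Sum>i\<le>N. c i * x ^ i)"
      using g(1) by (auto simp: real_polynomial_function_iff_sum)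
    then have "g x = poly (\<Sum>i\<le>N. monom (c i) i) x" for x
      by (simp add: poly_sum poly_monom)
    then show ?thesis using g(2) by metis
  qed
  then obtain P where P: "\<And>n x. x \<in> {a..b} \<Longrightarrow> \<bar>f x - poly (P n) x\<bar> < inverse (real (Suc n))"
    by metis
  have "uniform_limit {a..b} (\<lambda>n. poly (P n)) f sequentially"
  proof (rule uniform_limitI)
    fix e :: real assume "0 < e"
    then have "\<forall>\<^sub>F n in sequentially. inverse (real (Suc n)) < e"
      using LIMSEQ_inverse_real_of_nat order_tendstoD(2) by blast
    then show "\<forall>\<^sub>F n in sequentially. \<forall>x\<in>{a..b}. dist (poly (P n) x) (f x) < e"
      by eventually_elim (metis P dist_commute dist_real_def less_trans)
  qed
  then show ?thesis by (rule that)
qed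

text \<open>Functions are taken continuous on an enclosing interval, so that Weierstrass applies
  directly and compactness of the spectrum is not at issue.\<close>

locale spectral_interval =
  fixes T :: "'a::chilbert_space \<Rightarrow>\<^sub>L 'a" and a b :: real
  assumes selfadjoint: "selfadjoint T"
    and spectrum_subset: "real_spectrum T \<subseteq> {a..b}"
begin

text \<open>By \<open>op_poly_norm_le\<close> uniform closeness on the spectrum bounds the operator
  norm, and the operator space is complete.\<close>

lemma op_poly_limit_exists:
  assumes "uniform_limit (real_spectrum T) (\<lambda>n. poly (P n)) f sequentially"
  obtains S where "(\<lambda>n. op_poly (P n) T) \<longlonglongrightarrow> S"
proof -
  have "Cauchy (\<lambda>n. op_poly (P n) T)"
  proof (rule metric_CauchyI)
    fix e :: real assume "0 < e"
    \<comment> \<open>Two errors add up to \<open>2 e / 3\<close>, which leaves room for a strict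
      inequality after the non-strict norm bound.\<close>
    then have e: "0 < e / 3" by simp
    obtain N where N: "\<And>n t. n \<ge> N \<Longrightarrow> t \<in> real_spectrum T \<Longrightarrow> \<bar>poly (P n) t - f t\<bar> < e / 3"
      using uniform_limitD[OF assms e] by (auto simp: eventually_sequentially dist_real_def)
    have "dist (op_poly (P m) T) (op_poly (P n) T) < e" if "m \<ge> N" "n \<ge> N" for m n
    proof -
      have "norm (op_poly (P m - P n) T) \<le> 2 * (e / 3)"
      proof (rule op_poly_norm_le[OF selfadjoint])
        fix t assume "t \<in> real_spectrum T"
        then show "\<bar>poly (P m - P n) t\<bar> \<le> 2 * (e / 3)"
          using N[OF that(1)] N[OF that(2)] by (smt (verit) poly_diff)
      qed (use e in simp)
      also have "\<dots> < e" using e by simp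
      finally show ?thesis by (simp add: dist_norm op_poly_diff)
    qed
    then show "\<exists>N. \<forall>m\<ge>N. \<forall>n\<ge>N. dist (op_poly (P m) T) (op_poly (P n) T) < e"
      by blast
  qed
  then show ?thesis
    using that by (auto simp: Cauchy_convergent_iff convergent_def)
qed

lemma op_poly_limit_unique:
  assumes P: "uniform_limit (real_spectrum T) (\<lambda>n. poly (P n)) f sequentially"
    and Q: "uniform_limit (real_spectrum T) (\<lambda>n. poly (Q n)) f sequentially"
    and S: "(\<lambda>n. op_poly (P n) T) \<longlonglongrightarrow> S"
  shows "(\<lambda>n. op_poly (Q n) T) \<longlonglongrightarrow> S"
proof -
  have "(\<lambda>n. op_poly (Q n) T - op_poly (P n) T) \<longlonglongrightarrow> 0"
  proof (rule tendstoI)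
    fix e :: real assume "0 < e"
    then have e: "0 < e / 3" by simp
    show "\<forall>\<^sub>F n in sequentially. dist (op_poly (Q n) T - op_poly (P n) T) 0 < e"
      using uniform_limitD[OF P e] uniform_limitD[OF Q e]
    proof eventually_elim
      case (elim n)
      have "norm (op_poly (Q n - P n) T) \<le> 2 * (e / 3)"
      proof (rule op_poly_norm_le[OF selfadjoint])
        fix t assume t: "t \<in> real_spectrum T"
        show "\<bar>poly (Q n - P n) t\<bar> \<le> 2 * (e / 3)"
          using bspec[OF elim(1) t] bspec[OF elim(2) t] unfolding dist_real_def poly_diff by linarith
      qed (use e in simp)
      also have "\<dots> < e" using e by simp
      finally show ?case by (simp add: op_poly_diff)
    qed
  qed
  from tendsto_add[OF this S] show ?thesis by simp
qed

lemma approximants: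
  assumes "continuous_on {a..b} f"
  obtains P where "uniform_limit (real_spectrum T) (\<lambda>n. poly (P n)) f sequentially"
  using Weierstrass_uniform_limit[OF assms] uniform_limit_on_subset[OF _ spectrum_subset] by metis

text \<open>Existence of the limit and its independence of the approximating sequence make the
  description in \<open>cfc\<close> well defined; \<open>Q\<close> itself tests uniqueness.\<close>

lemma cfc_tendsto:
  assumes f: "continuous_on {a..b} f"
    and Q: "uniform_limit (real_spectrum T) (\<lambda>n. poly (Q n)) f sequentially"
  shows "(\<lambda>n. op_poly (Q n) T) \<longlonglongrightarrow> cfc f T"
proof -
  let ?lim = "\<lambda>S. \<forall>P :: nat \<Rightarrow> real poly.
     uniform_limit (real_spectrum T) (\<lambda>n. poly (P n)) f sequentially
       \<longrightarrow> (\<lambda>n. op_poly (P n) T) \<longlonglongrightarrow> S"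
  obtain S where S: "(\<lambda>n. op_poly (Q n) T) \<longlonglongrightarrow> S"
    using op_poly_limit_exists[OF Q] by blast
  have "?lim S"
    using op_poly_limit_unique[OF Q _ S] by blast
  moreover have "S' = S" if "?lim S'" for S'
    using LIMSEQ_unique[OF that[rule_format, OF Q] S] .
  ultimately have "cfc f T = S"
    unfolding cfc_def by (rule the_equality)
  with S show ?thesis by simp
qed

lemma cfc_eqI:
  assumes "continuous_on {a..b} f"
    and "uniform_limit (real_spectrum T) (\<lambda>n. poly (P n)) f sequentially"
    and "(\<lambda>n. op_poly (P n) T) \<longlonglongrightarrow> S"
  shows "cfc f T = S"
  by (rule LIMSEQ_unique[OF cfc_tendsto[OF assms(1,2)] assms(3)])

text \<open>The definition of \<open>cfc\<close> sees a function only through its values on the real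
  spectrum.\<close>

lemma cfc_cong:
  assumes "\<And>t. t \<in> {a..b} \<Longrightarrow> f t = g t"
  shows "cfc f T = cfc g T"
proof -
  have "uniform_limit (real_spectrum T) (\<lambda>n. poly (P n)) f sequentially \<longleftrightarrow>
    uniform_limit (real_spectrum T) (\<lambda>n. poly (P n)) g sequentially" for P :: "nat \<Rightarrow> real poly"
    by (rule uniform_limit_cong') (use assms spectrum_subset in blast)+
  then show ?thesis by (simp add: cfc_def)
qed

section \<open>Algebra and positivity of the calculus\<close>

lemma cfc_poly: "cfc (poly P) T = op_poly P T"
proof (rule cfc_eqI)
  show "continuous_on {a..b} (poly P)"
    by (intro continuous_intros)
  show "uniform_limit (real_spectrum T) (\<lambda>n. poly P) (poly P) sequentially"
    by (rule uniform_limit_const)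
qed (rule tendsto_const)

lemma cfc_const: "cfc (\<lambda>t. c) T = c *\<^sub>R id_blinfun"
proof -
  have "poly [:c:] = (\<lambda>t. c)" by auto
  then show ?thesis using cfc_poly[of "[:c:]"] by simp
qed

lemma cfc_ident: "cfc (\<lambda>t. t) T = T"
proof -
  have "poly [:0, 1:] = (\<lambda>t::real. t)" by auto
  then show ?thesis using cfc_poly[of "[:0, 1:]"] by simp
qed

lemma cfc_diff:
  assumes f: "continuous_on {a..b} f" and g: "continuous_on {a..b} g"
  shows "cfc (\<lambda>t. f t - g t) T = cfc f T - cfc g T"
proof -
  obtain P where P: "uniform_limit (real_spectrum T) (\<lambda>n. poly (P n)) f sequentially"
    using approximants[OF f] .
  obtain Q where Q: "uniform_limit (real_spectrum T) (\<lambda>n. poly (Q n)) g sequentially"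
    using approximants[OF g] .
  show ?thesis
  proof (rule cfc_eqI[where P = "\<lambda>n. P n - Q n"])
    show "continuous_on {a..b} (\<lambda>t. f t - g t)"
      by (intro continuous_intros f g)
    have "poly (P n - Q n) = (\<lambda>t. poly (P n) t - poly (Q n) t)" for n
      by (rule ext) simp
    then show "uniform_limit (real_spectrum T) (\<lambda>n. poly (P n - Q n)) (\<lambda>t. f t - g t) sequentially"
      using uniform_limit_minus[OF P Q] by simp
    show "(\<lambda>n. op_poly (P n - Q n) T) \<longlonglongrightarrow> cfc f T - cfc g T"
      unfolding op_poly_diff by (intro tendsto_diff cfc_tendsto f g P Q)
  qed
qed

lemma cfc_mult:
  assumes f: "continuous_on {a..b} f" and g: "continuous_on {a..b} g"
  shows "cfc (\<lambda>t. f t * g t) T = cfc f T o\<^sub>L cfc g T"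
proof -
  obtain P where P: "uniform_limit (real_spectrum T) (\<lambda>n. poly (P n)) f sequentially"
    using approximants[OF f] .
  obtain Q where Q: "uniform_limit (real_spectrum T) (\<lambda>n. poly (Q n)) g sequentially"
    using approximants[OF g] .
  \<comment> \<open>Uniform limits multiply when the limit functions are bounded, here by
    compactness of \<open>{a..b}\<close>.\<close>
  have bounded: "bounded (h ` real_spectrum T)" if "continuous_on {a..b} h" for h :: "real \<Rightarrow> real"
    by (rule bounded_subset[OF _ image_mono[OF spectrum_subset]])
      (intro compact_imp_bounded compact_continuous_image that compact_Icc)
  show ?thesis
  proof (rule cfc_eqI[where P = "\<lambda>n. P n * Q n"])
    show "continuous_on {a..b} (\<lambda>t. f t * g t)"
      by (intro continuous_intros f g)
    have "poly (P n * Q n) = (\<lambda>t. poly (P n) t * poly (Q n) t)" for n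
      by (rule ext) simp
    then show "uniform_limit (real_spectrum T) (\<lambda>n. poly (P n * Q n)) (\<lambda>t. f t * g t) sequentially"
      using uniform_lim_mult[OF P Q bounded[OF f] bounded[OF g]] by simp
    show "(\<lambda>n. op_poly (P n * Q n) T) \<longlonglongrightarrow> (cfc f T o\<^sub>L cfc g T)"
      unfolding op_poly_mult by (intro tendsto_blinfun_compose cfc_tendsto f g P Q)
  qed
qed

lemma cfc_scale:
  assumes "continuous_on {a..b} f"
  shows "cfc (\<lambda>t. c * f t) T = c *\<^sub>R cfc f T"
  using cfc_mult[OF continuous_on_const assms] by (simp add: cfc_const compose_bilinear)

lemma cfc_selfadjoint:
  assumes "continuous_on {a..b} f"
  shows "selfadjoint (cfc f T)"
proof -
  obtain P where "uniform_limit (real_spectrum T) (\<lambda>n. poly (P n)) f sequentially"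
    using approximants[OF assms] .
  from selfadjoint_limit[OF cfc_tendsto[OF assms this]] show ?thesis
    using op_poly_selfadjoint[OF selfadjoint] .
qed

lemma cfc_positive:
  assumes f: "continuous_on {a..b} f" and pos: "\<And>t. t \<in> {a..b} \<Longrightarrow> 0 \<le> f t"
  shows "positive_op (cfc f T)"
proof -
  \<comment> \<open>\<open>f(T)\<close> is the square of the selfadjoint operator \<open>(sqrt f)(T)\<close>.\<close>
  let ?g = "\<lambda>t. sqrt (f t)"
  have g: "continuous_on {a..b} ?g" by (intro continuous_intros f)
  have "cfc f T = cfc (\<lambda>t. ?g t * ?g t) T"
    by (rule cfc_cong) (use pos in simp)
  also have "\<dots> = cfc ?g T o\<^sub>L id_blinfun o\<^sub>L cfc ?g T"
    using cfc_mult[OF g g] by simp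
  finally show ?thesis
    using positive_sandwich[OF cfc_selfadjoint[OF g], of id_blinfun]
    by (simp add: positive_op_def selfadjoint_id rinner_self)
qed

end

section \<open>Spectrum of a strictly positive operator\<close>

lemma strictly_positive_spectral_interval:
  assumes "strictly_positive_op T"
  obtains a b where "0 < a" "spectral_interval T a b"
proof -
  have T: "selfadjoint T"
    using assms by (simp add: strictly_positive_op_def positive_op_def)
  \<comment> \<open>The coercivity constant becomes the lower end; its positivity makes all real
    powers continuous on the interval.\<close>
  obtain a where a: "0 < a" "\<And>x. a * (norm x)\<^sup>2 \<le> rinner (T x) x"
    using assms positive_invertible_coercive unfolding strictly_positive_op_def by metis
  have "t \<in> {a..norm T}" if t: "t \<in> real_spectrum T" for t
  proof (rule ccontr)
    have bop: "T - t *\<^sub>R id_blinfun \<in> bop" "t *\<^sub>R id_blinfun - T \<in> bop"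
      using T by (auto intro: bop_diff bop_scaleR bop_id selfadjoint_bop)
    have ninv: "\<not> op_invertible (T - t *\<^sub>R id_blinfun)" "\<not> op_invertible (t *\<^sub>R id_blinfun - T)"
      using t op_invertible_scaleR[of "t *\<^sub>R id_blinfun - T" "-1"] by (auto simp: real_spectrum_iff)
    assume "t \<notin> {a..norm T}"
    \<comment> \<open>Left of \<open>a\<close> the operator \<open>T - t\<close> is coercive, right
      of \<open>norm T\<close> the operator \<open>t - T\<close> is.\<close>
    then consider "0 < a - t" | "0 < t - norm T" by fastforce
    then show False
    proof cases
      case 1
      have "(a - t) * (norm x)\<^sup>2 \<le> rinner ((T - t *\<^sub>R id_blinfun) x) x" for x
        using a(2)[of x] by (simp add: blinfun.bilinear_simps rinner_simps rinner_self algebra_simps)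
      then show ?thesis using coercive_invertible[OF bop(1) 1] ninv by blast
    next
      case 2
      have "(t - norm T) * (norm x)\<^sup>2 \<le> rinner ((t *\<^sub>R id_blinfun - T) x) x" for x
        using rinner_apply_le[of T x]
        by (simp add: blinfun.bilinear_simps rinner_simps rinner_self algebra_simps)
      then show ?thesis using coercive_invertible[OF bop(2) 2] ninv by blast
    qed
  qed
  then have "spectral_interval T a (norm T)"
    using T by unfold_locales auto
  with a(1) show ?thesis by (rule that)
qed

subsection \<open>Weighted means\<close>

text \<open>Convexity of \<open>exp\<close> between \<open>0\<close> and \<open>q ln t\<close> with
  weight \<open>p / q\<close>, which yields the point \<open>p ln t\<close>.\<close>

lemma powr_quotient_mono:
  fixes t p q :: real
  assumes "0 < t" "0 < p" "p \<le> q"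
  shows "(t powr p - 1) / p \<le> (t powr q - 1) / q"
proof -
  have "exp ((1 - p / q) *\<^sub>R 0 + (p / q) *\<^sub>R (q * ln t)) \<le> (1 - p / q) * exp 0 + (p / q) * exp (q * ln t)"
    using assms by (intro convex_onD[OF exp_convex]) auto
  then have "t powr p \<le> 1 - p / q + p / q * t powr q"
    using assms by (simp add: powr_def)
  then have "t powr p - 1 \<le> p * ((t powr q - 1) / q)"
    by (simp add: field_simps diff_divide_distrib)
  then show ?thesis
    using assms by (simp add: pos_divide_le_eq mult.commute)
qed

lemma continuous_on_powr_Icc:
  fixes a b r :: real
  assumes "0 < a"
  shows "continuous_on {a..b} (\<lambda>t. t powr r)"
  using assms by (intro continuous_intros) auto

theorem proposition4p1:
  fixes A B :: "'a::chilbert_space \<Rightarrow>\<^sub>L 'a" and p q :: real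
  assumes "strictly_positive_op A" and "strictly_positive_op B"
    and "p \<in> {0<..1}" and "q \<in> {0<..1}" and "p \<le> q"
  shows "(A \<nabla>\<^bsub>q\<^esub> B - A \<sharp>\<^bsub>q\<^esub> B) /\<^sub>R q \<le>\<^sub>o\<^sub>p (A \<nabla>\<^bsub>p\<^esub> B - A \<sharp>\<^bsub>p\<^esub> B) /\<^sub>R p"
proof -
  obtain a b where a: "0 < a" and "spectral_interval A a b"
    using strictly_positive_spectral_interval[OF assms(1)] .
  then interpret A: spectral_interval A a b by simp
  note cont_A = continuous_on_powr_Icc[OF a, of b]
  define H where "H = op_powr A (1/2)"
  define K where "K = op_powr A (- 1/2)"
  define C where "C = K o\<^sub>L B o\<^sub>L K"
  have H: "selfadjoint H" and K: "selfadjoint K"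
    by (auto simp: H_def K_def op_powr_def intro!: A.cfc_selfadjoint cont_A)
  have powr_compose: "op_powr A r o\<^sub>L op_powr A s = cfc (\<lambda>t. t powr (r + s)) A" for r s
    by (simp add: op_powr_def powr_add A.cfc_mult cont_A)
  \<comment> \<open>Since \<open>0 powr 0 = 0\<close>, this rests on \<open>a > 0\<close>. The simp
    rule \<open>powr_zero_eq_one\<close> is switched off below so that this equation still
    matches.\<close>
  have one: "cfc (\<lambda>t. t powr 0) A = id_blinfun"
    using A.cfc_cong[of "\<lambda>t. t powr 0" "\<lambda>t. 1"] A.cfc_const[of 1] a by simp
  have HK: "H o\<^sub>L K = id_blinfun" and KH: "K o\<^sub>L H = id_blinfun"
    by (simp_all add: H_def K_def powr_compose one del: powr_zero_eq_one)
  have HH: "H o\<^sub>L H = A"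
    using A.cfc_cong[of "\<lambda>t. t powr 1" "\<lambda>t. t"] a
    by (simp add: H_def powr_compose A.cfc_ident)
  have HCH: "H o\<^sub>L C o\<^sub>L H = B"
  proof -
    have "H o\<^sub>L C o\<^sub>L H = (H o\<^sub>L K) o\<^sub>L B o\<^sub>L (K o\<^sub>L H)"
      by (simp only: C_def blinfun_compose_assoc)
    then show ?thesis by (simp add: HK KH)
  qed
  \<comment> \<open>\<open>H\<close> inverts \<open>K\<close>, so \<open>C\<close> is a congruence
    of \<open>B\<close> by an invertible selfadjoint operator and inherits strict
    positivity.\<close>
  have "op_invertible K"
    unfolding op_invertible_def using H HK KH by (auto intro: selfadjoint_bop)
  then have "strictly_positive_op C"
    using assms(2) K unfolding strictly_positive_op_def C_def
    by (auto intro!: positive_sandwich op_invertible_compose)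
  then obtain c d where c: "0 < c" and "spectral_interval C c d"
    using strictly_positive_spectral_interval by blast
  then interpret C: spectral_interval C c d by simp
  note cont_C = continuous_on_powr_Icc[OF c, of d]
  \<comment> \<open>\<open>h r\<close> carries all dependence on \<open>r\<close>; the product form
    suits \<open>cfc_scale\<close>.\<close>
  define h where "h r = (\<lambda>t::real. (1 / r) * (1 - t powr r))" for r :: real
  have cont_h: "continuous_on {c..d} (h r)" for r
    unfolding h_def by (intro continuous_intros cont_C)
  have h: "cfc (h r) C = (1 / r) *\<^sub>R (id_blinfun - op_powr C r)" for r
    unfolding h_def op_powr_def
    by (simp only: C.cfc_scale C.cfc_diff C.cfc_const cont_C continuous_on_diff
        continuous_on_const scaleR_one)
  \<comment> \<open>Substituting \<open>A = H H\<close> and \<open>B = H C H\<close> puts the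
    quotients for all \<open>r\<close> into the same sandwich, with the common summand
    \<open>C - 1\<close>.\<close>
  have mean: "(A \<nabla>\<^bsub>r\<^esub> B - A \<sharp>\<^bsub>r\<^esub> B) /\<^sub>R r = H o\<^sub>L (cfc (h r) C + (C - id_blinfun)) o\<^sub>L H"
    if "0 < r" for r
  proof -
    have "A \<sharp>\<^bsub>r\<^esub> B = H o\<^sub>L op_powr C r o\<^sub>L H"
      by (simp add: geom_mean_def H_def K_def C_def)
    moreover have "H o\<^sub>L (cfc (h r) C + (C - id_blinfun)) o\<^sub>L H
        = (1 / r) *\<^sub>R (A - (H o\<^sub>L op_powr C r o\<^sub>L H)) + (B - A)"
      by (simp add: h compose_bilinear HH HCH)
    moreover have "(1 / r) *\<^sub>R ((1 - r) *\<^sub>R A + r *\<^sub>R B - G) = (1 / r) *\<^sub>R (A - G) + (B - A)" for G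
      using that by (simp add: scaleR_left_diff_distrib scaleR_right_diff_distrib scaleR_add_right)
    ultimately show ?thesis by (simp add: arith_mean_def inverse_eq_divide)
  qed
  have sa: "selfadjoint ((A \<nabla>\<^bsub>r\<^esub> B - A \<sharp>\<^bsub>r\<^esub> B) /\<^sub>R r)" if "0 < r" for r
    unfolding mean[OF that]
    by (intro selfadjoint_sandwich selfadjoint_add selfadjoint_diff selfadjoint_id H
        C.selfadjoint C.cfc_selfadjoint cont_h)
  \<comment> \<open>The sign in \<open>h\<close> makes it decreasing in \<open>r\<close>, so the
    term for \<open>p\<close> dominates.\<close>
  have "positive_op (cfc (\<lambda>t. h p t - h q t) C)"
  proof (rule C.cfc_positive)
    show "continuous_on {c..d} (\<lambda>t. h p t - h q t)"
      by (intro continuous_on_diff cont_h)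
    fix t assume "t \<in> {c..d}"
    then have "(t powr p - 1) / p \<le> (t powr q - 1) / q"
      using assms c by (intro powr_quotient_mono) auto
    then show "0 \<le> h p t - h q t"
      by (simp add: h_def diff_divide_distrib)
  qed
  then have "positive_op (H o\<^sub>L (cfc (h p) C - cfc (h q) C) o\<^sub>L H)"
    using H by (simp add: positive_sandwich C.cfc_diff cont_h)
  \<comment> \<open>Applied with \<open>E = C - 1\<close>, which cancels.\<close>
  moreover have "(H o\<^sub>L (P + E) o\<^sub>L H) - (H o\<^sub>L (Q + E) o\<^sub>L H) = H o\<^sub>L (P - Q) o\<^sub>L H" for P Q E
    by (rule blinfun_eqI) (simp add: blinfun.bilinear_simps)
  moreover have pq: "0 < p" "0 < q" using assms by auto
  ultimately have le: "positive_op ((A \<nabla>\<^bsub>p\<^esub> B - A \<sharp>\<^bsub>p\<^esub> B) /\<^sub>R p - (A \<nabla>\<^bsub>q\<^esub> B - A \<sharp>\<^bsub>q\<^esub> B) /\<^sub>R q)"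
    by (simp only: mean)
  show ?thesis
    unfolding op_le_def by (rule conjI[OF sa[OF pq(2)] conjI[OF sa[OF pq(1)] le]])
qed

end
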